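(* Let $R$ be a commutative semiring that is zero-sum-free and integral. Let $X,Y$ be simplicial sets and let $\varphi_1,\varphi_2\in\mathrm{sSet}(X,Y)$ be such that there is no simplicial homotopy from $\varphi_1$ to $\varphi_2$. If $F\in\mathrm{sSet}(X\times\Delta[1],D_R(Y))$ is the unique simplicial homotopy from $\delta_Y\circ\varphi_1$ to $\delta_Y\circ\varphi_2$, then $F$ is a strongly contextual vertex in $\mathrm{sSet}(X\times\Delta[1],D_R(Y))$, i.e. $F$ is strongly contextual and is a vertex of this $R$-convex set.
   Context: A semiring is zero-sum-free if $a+b=0$ implies $a=b=0$, and integral if $ab=0$ implies $a=0$ or $b=0$. For a set $S$, $D_R(S)$ is the set of functions $p:S\to R$ of finite support with $\sum_s p(s)=1$; $D_R(f)(p)(t)=\sum_{f(s)=t}p(s)$; $\delta^s$ is the delta distribution. For a simplicial set $Y$, $D_R(Y)$ is obtained by applying $D_R$ degreewise, and $\delta_Y:Y\to D_R(Y)$ is the simplicial map $y\mapsto\delta^y$. A simplicial homotopy from $f_0:X\to Y$ to $f_1:X\to Y$ is a simplicial map $F:X\times\Delta[1]\to Y$ with $f_0=F\circ i_1$ and $f_1=F\circ i_0$, where $i_k:X\cong X\times\Delta[0]\xrightarrow{\mathrm{id}\times d^k}X\times\Delta[1]$ and $d^k:\Delta[0]\to\Delta[1]$ is the $k$-th coface. For $p\in\mathrm{sSet}(Z,D_R(Y))$, $\mathrm{supp}(p)=\{\varphi\in\mathrm{sSet}(Z,Y):p_n(z)(\varphi_n(z))\neq0\ \forall z\in Z_n,\,n\ge0\}$,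 and $p$ is strongly contextual if $\mathrm{supp}(p)=\emptyset$. $\mathrm{sSet}(Z,D_R(Y))$ is an $R$-convex set ($D_R$-algebra) via $\pi(Q)_n(z)=\sum_{p}Q(p)p_n(z)$ for $Q\in D_R(\mathrm{sSet}(Z,D_R(Y)))$. An element $x$ of an $R$-convex set $(S,\pi^S:D_R(S)\to S)$ is a vertex if it has a unique preimage under $\pi^S$. *)

theory Defs
  imports Main "HOL-Library.FuncSet"
begin

text \<open>
  The semiring of scalars is a type of sort \<open>{comm_semiring_0, comm_monoid_mult}\<close>, that is, a
  commutative semiring with \<open>0\<close> and \<open>1\<close>.  The class \<open>comm_semiring_1\<close> is not used because it
  also requires \<open>0 \<noteq> 1\<close>.
\<close>

subsection \<open>Simplicial sets\<close>

text \<open>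
  Morphisms $[m] \to [n]$ of the simplex category are monotone maps $\{0,\dots,m\} \to
  \{0,\dots,n\}$, made extensional so that equality of morphisms is equality of functions.
\<close>

definition Delta_hom :: "nat \<Rightarrow> nat \<Rightarrow> (nat \<Rightarrow> nat) set" where
  "Delta_hom m n = {\<theta> \<in> {..m} \<rightarrow>\<^sub>E {..n}. mono_on {..m} \<theta>}"

text \<open>
  A simplicial set is a contravariant functor on the simplex category: \<open>act X m n \<theta>\<close> is the map
  $X_n \to X_m$ induced by $\theta : [m] \to [n]$.
\<close>

record 'a sset =
  cells :: "nat \<Rightarrow> 'a set"
  act :: "nat \<Rightarrow> nat \<Rightarrow> (nat \<Rightarrow> nat) \<Rightarrow> 'a \<Rightarrow> 'a"

locale simplicial_set =
  fixes X :: "'a sset"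
  assumes act_closed:
      "\<lbrakk>\<theta> \<in> Delta_hom m n; x \<in> cells X n\<rbrakk> \<Longrightarrow> act X m n \<theta> x \<in> cells X m"
    and act_id:
      "x \<in> cells X n \<Longrightarrow> act X n n (\<lambda>j\<in>{..n}. j) x = x"
    and act_comp:
      "\<lbrakk>\<eta> \<in> Delta_hom l m; \<theta> \<in> Delta_hom m n; x \<in> cells X n\<rbrakk>
        \<Longrightarrow> act X l n (compose {..l} \<theta> \<eta>) x = act X l m \<eta> (act X m n \<theta> x)"

text \<open>
  The set of simplicial maps.  Components are extensional, so two simplicial maps are equal as
  HOL functions exactly when they agree on all simplices.
\<close>

definition sSet :: "'a sset \<Rightarrow> 'b sset \<Rightarrow> (nat \<Rightarrow> 'a \<Rightarrow> 'b) set" where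
  "sSet X Y = {f. (\<forall>n. f n \<in> cells X n \<rightarrow>\<^sub>E cells Y n) \<and>
     (\<forall>m n \<theta> x. \<theta> \<in> Delta_hom m n \<longrightarrow> x \<in> cells X n \<longrightarrow>
        f m (act X m n \<theta> x) = act Y m n \<theta> (f n x))}"

definition smap_comp ::
  "'a sset \<Rightarrow> (nat \<Rightarrow> 'b \<Rightarrow> 'c) \<Rightarrow> (nat \<Rightarrow> 'a \<Rightarrow> 'b) \<Rightarrow> nat \<Rightarrow> 'a \<Rightarrow> 'c" where
  "smap_comp X g f = (\<lambda>n. compose (cells X n) (g n) (f n))"

definition sprod :: "'a sset \<Rightarrow> 'b sset \<Rightarrow> ('a \<times> 'b) sset" where
  "sprod X Y = \<lparr>cells = (\<lambda>n. cells X n \<times> cells Y n),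
     act = (\<lambda>m n \<theta>. map_prod (act X m n \<theta>) (act Y m n \<theta>))\<rparr>"

definition std_simplex :: "nat \<Rightarrow> (nat \<Rightarrow> nat) sset" where
  "std_simplex k = \<lparr>cells = (\<lambda>n. Delta_hom n k),
     act = (\<lambda>m n \<theta> \<sigma>. compose {..m} \<sigma> \<theta>)\<rparr>"

text \<open>The coface $d^i : [n] \to [n+1]$ is the injective monotone map omitting \<open>i\<close>.\<close>

definition coface :: "nat \<Rightarrow> nat \<Rightarrow> nat \<Rightarrow> nat" where
  "coface n i = (\<lambda>j\<in>{..n}. if j < i then j else Suc j)"

definition std_simplex_map :: "nat \<Rightarrow> (nat \<Rightarrow> nat) \<Rightarrow> nat \<Rightarrow> (nat \<Rightarrow> nat) \<Rightarrow> nat \<Rightarrow> nat" where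
  "std_simplex_map k \<alpha> = (\<lambda>n. \<lambda>\<sigma>\<in>Delta_hom n k. compose {..n} \<alpha> \<sigma>)"

text \<open>
  \<open>end_incl X k\<close> is $X \cong X \times \Delta[0] \to X \times \Delta[1]$ induced by $d^k$;
  \<open>\<lambda>j\<in>{..n}. 0\<close> is the only \<open>n\<close>-simplex of $\Delta[0]$.
\<close>

definition end_incl :: "'a sset \<Rightarrow> nat \<Rightarrow> nat \<Rightarrow> 'a \<Rightarrow> 'a \<times> (nat \<Rightarrow> nat)" where
  "end_incl X k =
     (\<lambda>n. \<lambda>x\<in>cells X n. (x, std_simplex_map 0 (coface 0 k) n (\<lambda>j\<in>{..n}. 0)))"

definition simplicial_homotopy ::
  "'a sset \<Rightarrow> 'b sset \<Rightarrow> (nat \<Rightarrow> 'a \<Rightarrow> 'b) \<Rightarrow> (nat \<Rightarrow> 'a \<Rightarrow> 'b)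
    \<Rightarrow> (nat \<Rightarrow> 'a \<times> (nat \<Rightarrow> nat) \<Rightarrow> 'b) \<Rightarrow> bool" where
  "simplicial_homotopy X Y f0 f1 F \<longleftrightarrow>
     F \<in> sSet (sprod X (std_simplex 1)) Y \<and>
     f0 = smap_comp X F (end_incl X 1) \<and> f1 = smap_comp X F (end_incl X 0)"


subsection \<open>Distributions\<close>

text \<open>A distribution on \<open>S\<close> is encoded as a function on the ambient type vanishing outside \<open>S\<close>.\<close>

definition dist_on :: "'s set \<Rightarrow> ('s \<Rightarrow> 'r::{comm_semiring_0, comm_monoid_mult}) set" where
  "dist_on S = {p. finite {s. p s \<noteq> 0} \<and> {s. p s \<noteq> 0} \<subseteq> S \<and> (\<Sum>s | p s \<noteq> 0. p s) = 1}"

definition dist_map ::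
  "('s \<Rightarrow> 't) \<Rightarrow> ('s \<Rightarrow> 'r::{comm_semiring_0, comm_monoid_mult}) \<Rightarrow> 't \<Rightarrow> 'r" where
  "dist_map f p = (\<lambda>t. \<Sum>s | p s \<noteq> 0 \<and> f s = t. p s)"

definition delta :: "'s \<Rightarrow> 's \<Rightarrow> 'r::{comm_semiring_0, comm_monoid_mult}" where
  "delta s = (\<lambda>t. if t = s then 1 else 0)"

definition dist_sset ::
  "'b sset \<Rightarrow> ('b \<Rightarrow> 'r::{comm_semiring_0, comm_monoid_mult}) sset" where
  "dist_sset Y = \<lparr>cells = (\<lambda>n. dist_on (cells Y n)), act = (\<lambda>m n \<theta>. dist_map (act Y m n \<theta>))\<rparr>"

definition delta_sset ::
  "'b sset \<Rightarrow> nat \<Rightarrow> 'b \<Rightarrow> 'b \<Rightarrow> 'r::{comm_semiring_0, comm_monoid_mult}" where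
  "delta_sset Y = (\<lambda>n. \<lambda>y\<in>cells Y n. delta y)"

definition supp ::
  "'z sset \<Rightarrow> 'b sset \<Rightarrow> (nat \<Rightarrow> 'z \<Rightarrow> 'b \<Rightarrow> 'r::{comm_semiring_0, comm_monoid_mult})
    \<Rightarrow> (nat \<Rightarrow> 'z \<Rightarrow> 'b) set" where
  "supp Z Y p = {\<phi> \<in> sSet Z Y. \<forall>n. \<forall>z \<in> cells Z n. p n z (\<phi> n z) \<noteq> 0}"

definition strongly_contextual ::
  "'z sset \<Rightarrow> 'b sset \<Rightarrow> (nat \<Rightarrow> 'z \<Rightarrow> 'b \<Rightarrow> 'r::{comm_semiring_0, comm_monoid_mult})
    \<Rightarrow> bool" where
  "strongly_contextual Z Y p \<longleftrightarrow> supp Z Y p = {}"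


subsection \<open>Convex sets over a semiring\<close>

text \<open>
  \<open>dist_join\<close> is the multiplication $D_R(D_R(S)) \to D_R(S)$ of the distribution monad.
\<close>

definition dist_join ::
  "(('s \<Rightarrow> 'r) \<Rightarrow> 'r) \<Rightarrow> 's \<Rightarrow> 'r::{comm_semiring_0, comm_monoid_mult}" where
  "dist_join P = (\<lambda>s. \<Sum>p | P p \<noteq> 0. P p * p s)"

locale convex_set =
  fixes S :: "'s set"
    and \<pi> :: "('s \<Rightarrow> 'r::{comm_semiring_0, comm_monoid_mult}) \<Rightarrow> 's"
  assumes str_closed: "Q \<in> dist_on S \<Longrightarrow> \<pi> Q \<in> S"
    and str_delta: "s \<in> S \<Longrightarrow> \<pi> (delta s) = s"
    and str_join: "P \<in> dist_on (dist_on S) \<Longrightarrow> \<pi> (dist_map \<pi> P) = \<pi> (dist_join P)"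

definition vertex ::
  "'s set \<Rightarrow> (('s \<Rightarrow> 'r::{comm_semiring_0, comm_monoid_mult}) \<Rightarrow> 's) \<Rightarrow> 's \<Rightarrow> bool" where
  "vertex S \<pi> x \<longleftrightarrow> x \<in> S \<and> (\<exists>!Q. Q \<in> dist_on S \<and> \<pi> Q = x)"

definition sSet_str ::
  "'z sset \<Rightarrow> ((nat \<Rightarrow> 'z \<Rightarrow> 'b \<Rightarrow> 'r) \<Rightarrow> 'r)
    \<Rightarrow> nat \<Rightarrow> 'z \<Rightarrow> 'b \<Rightarrow> 'r::{comm_semiring_0, comm_monoid_mult}" where
  "sSet_str Z Q = (\<lambda>n. \<lambda>z\<in>cells Z n. \<lambda>y. \<Sum>p | Q p \<noteq> 0. Q p * p n z y)"


subsection \<open>Well-definedness\<close>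

lemma Delta_hom_compose:
  assumes "\<eta> \<in> Delta_hom l m" "\<theta> \<in> Delta_hom m n"
  shows "compose {..l} \<theta> \<eta> \<in> Delta_hom l n"
  using assms unfolding Delta_hom_def compose_def
  by (auto simp: PiE_iff mono_on_def)

lemma Delta_hom_id: "(\<lambda>j\<in>{..n}. j) \<in> Delta_hom n n"
  unfolding Delta_hom_def by (auto simp: mono_on_def)

lemma coface_in_Delta_hom: "coface n i \<in> Delta_hom n (Suc n)"
  unfolding Delta_hom_def coface_def by (auto simp: mono_on_def)

lemma Delta_hom_0: "Delta_hom n 0 = {\<lambda>j\<in>{..n}. 0}"
  unfolding Delta_hom_def by (auto simp: mono_on_def PiE_iff fun_eq_iff extensional_def)

lemma simplicial_set_std_simplex: "simplicial_set (std_simplex k)"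
proof
  fix \<theta> m n x assume "\<theta> \<in> Delta_hom m n" "x \<in> cells (std_simplex k) n"
  then show "act (std_simplex k) m n \<theta> x \<in> cells (std_simplex k) m"
    by (simp add: std_simplex_def Delta_hom_compose)
next
  fix x n assume "x \<in> cells (std_simplex k) n"
  then show "act (std_simplex k) n n (\<lambda>j\<in>{..n}. j) x = x"
    by (auto simp: std_simplex_def Delta_hom_def compose_def PiE_iff extensional_def fun_eq_iff)
next
  fix \<eta> l m \<theta> n x
  assume "\<eta> \<in> Delta_hom l m" "\<theta> \<in> Delta_hom m n" "x \<in> cells (std_simplex k) n"
  then show "act (std_simplex k) l n (compose {..l} \<theta> \<eta>) x
      = act (std_simplex k) l m \<eta> (act (std_simplex k) m n \<theta> x)"
    by (auto simp: std_simplex_def Delta_hom_def compose_def PiE_iff fun_eq_iff)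
qed

lemma simplicial_set_sprod:
  assumes "simplicial_set X" "simplicial_set Y"
  shows "simplicial_set (sprod X Y)"
proof -
  interpret X: simplicial_set X by fact
  interpret Y: simplicial_set Y by fact
  show ?thesis
    by standard
      (auto simp: sprod_def X.act_closed Y.act_closed X.act_id Y.act_id X.act_comp Y.act_comp)
qed

lemma std_simplex_map_in_sSet:
  assumes "\<alpha> \<in> Delta_hom k l"
  shows "std_simplex_map k \<alpha> \<in> sSet (std_simplex k) (std_simplex l)"
proof -
  have "compose {..m} \<alpha> (compose {..m} \<sigma> \<theta>) = compose {..m} (compose {..n} \<alpha> \<sigma>) \<theta>"
    if "\<theta> \<in> Delta_hom m n" for m n \<sigma> \<theta>
    using that by (auto simp: Delta_hom_def compose_def PiE_iff fun_eq_iff)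
  then show ?thesis
    using assms
    by (auto simp: sSet_def std_simplex_def std_simplex_map_def Delta_hom_compose)
qed

lemma smap_comp_in_sSet:
  assumes "simplicial_set X" "f \<in> sSet X Y" "g \<in> sSet Y Z"
  shows "smap_comp X g f \<in> sSet X Z"
  using assms simplicial_set.act_closed[OF assms(1)]
  by (auto simp: sSet_def smap_comp_def compose_def PiE_iff)

lemma end_incl_in_sSet:
  assumes "simplicial_set X"
  shows "end_incl X k \<in> sSet X (sprod X (std_simplex 1))"
proof -
  interpret simplicial_set X by fact
  let ?c = "std_simplex_map 0 (coface 0 k)"
  have c: "?c \<in> sSet (std_simplex 0) (std_simplex 1)"
    using std_simplex_map_in_sSet[OF coface_in_Delta_hom[of 0 k]] by simp
  have "?c n (\<lambda>j\<in>{..n}. 0) \<in> Delta_hom n 1" for n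
    using c by (auto simp: sSet_def std_simplex_def PiE_iff Delta_hom_0)
  moreover have "?c m (\<lambda>j\<in>{..m}. 0) = compose {..m} (?c n (\<lambda>j\<in>{..n}. 0)) \<theta>"
    if \<theta>: "\<theta> \<in> Delta_hom m n" for m n \<theta>
  proof -
    have *: "(\<lambda>j\<in>{..n}. 0) \<in> Delta_hom n 0" by (simp add: Delta_hom_0)
    have "compose {..m} (\<lambda>j\<in>{..n}. 0 :: nat) \<theta> = (\<lambda>j\<in>{..m}. 0)"
      using Delta_hom_compose[OF \<theta> *] by (simp add: Delta_hom_0)
    moreover have "?c m (compose {..m} (\<lambda>j\<in>{..n}. 0) \<theta>)
        = compose {..m} (?c n (\<lambda>j\<in>{..n}. 0)) \<theta>"
      using c \<theta> * unfolding sSet_def std_simplex_def by auto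
    ultimately show ?thesis by simp
  qed
  ultimately show ?thesis
    using act_closed
    by (auto simp: sSet_def sprod_def end_incl_def) (auto simp: std_simplex_def)
qed

lemma distD:
  assumes "p \<in> dist_on S"
  shows "finite {s. p s \<noteq> 0}" "{s. p s \<noteq> 0} \<subseteq> S" "(\<Sum>s | p s \<noteq> 0. p s) = 1"
  using assms unfolding dist_on_def by blast+

lemma dist_map_eq:
  assumes "finite A" "{s. p s \<noteq> 0} \<subseteq> A"
  shows "dist_map f p t = (\<Sum>s\<in>A. p s * (if f s = t then 1 else 0))"
  unfolding dist_map_def using assms
  by (intro sum.mono_neutral_cong_left) auto

lemma dist_map_supp: "{t. dist_map f p t \<noteq> 0} \<subseteq> f ` {s. p s \<noteq> 0}"
proof
  fix t assume t: "t \<in> {t. dist_map f p t \<noteq> 0}"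
  show "t \<in> f ` {s. p s \<noteq> 0}"
  proof (rule ccontr)
    assume "t \<notin> f ` {s. p s \<noteq> 0}"
    then have "{s. p s \<noteq> 0 \<and> f s = t} = {}" by blast
    then have "dist_map f p t = 0" unfolding dist_map_def by (simp only: sum.empty)
    then show False using t by simp
  qed
qed

text \<open>Change of variables along \<open>f\<close>.\<close>

lemma sum_dist_map:
  assumes "finite {s. p s \<noteq> 0}"
  shows "(\<Sum>t | dist_map f p t \<noteq> 0. dist_map f p t * h t) = (\<Sum>s | p s \<noteq> 0. p s * h (f s))"
proof -
  let ?A = "{s. p s \<noteq> 0}"
  have "(\<Sum>t | dist_map f p t \<noteq> 0. dist_map f p t * h t)
      = (\<Sum>t\<in>f ` ?A. dist_map f p t * h t)"
    using assms dist_map_supp[of f p] by (intro sum.mono_neutral_left) auto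
  also have "\<dots> = (\<Sum>t\<in>f ` ?A. \<Sum>s\<in>?A. p s * (if f s = t then 1 else 0) * h t)"
    using assms by (simp add: dist_map_eq[OF assms subset_refl] sum_distrib_right)
  also have "\<dots> = (\<Sum>s\<in>?A. \<Sum>t\<in>f ` ?A. p s * (if f s = t then 1 else 0) * h t)"
    by (rule sum.swap)
  also have "\<dots> = (\<Sum>s\<in>?A. \<Sum>t\<in>f ` ?A. if f s = t then p s * h t else 0)"
    by (intro sum.cong) auto
  also have "\<dots> = (\<Sum>s\<in>?A. p s * h (f s))"
    using assms by (intro sum.cong) auto
  finally show ?thesis .
qed

lemma dist_map_in_dist:
  assumes "p \<in> dist_on S" "\<And>s. s \<in> S \<Longrightarrow> f s \<in> T"
  shows "dist_map f p \<in> dist_on T"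
proof -
  note fin = distD(1)[OF assms(1)] and sub = distD(2)[OF assms(1)] and one = distD(3)[OF assms(1)]
  have "finite {t. dist_map f p t \<noteq> 0}"
    using dist_map_supp fin by (rule finite_subset[OF _ finite_imageI])
  moreover have "{t. dist_map f p t \<noteq> 0} \<subseteq> T"
    using dist_map_supp[of f p] sub assms(2) by blast
  moreover have "(\<Sum>t | dist_map f p t \<noteq> 0. dist_map f p t) = 1"
    using sum_dist_map[OF fin, of f "\<lambda>_. 1"] one by simp
  ultimately show ?thesis by (simp add: dist_on_def)
qed

lemma dist_map_id:
  assumes "p \<in> dist_on S" "\<And>s. s \<in> S \<Longrightarrow> f s = s"
  shows "dist_map f p = p"
proof (rule ext)
  fix t
  have f: "f s = s" if "p s \<noteq> 0" for s
    using distD(2)[OF assms(1)] assms(2) that by blast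
  have "{s. p s \<noteq> 0 \<and> f s = t} = {s. p s \<noteq> 0 \<and> s = t}"
    by (metis f)
  also have "\<dots> = (if p t = 0 then {} else {t})"
    by (cases "p t = 0") auto
  finally show "dist_map f p t = p t"
    unfolding dist_map_def by (simp split: if_split)
qed

lemma dist_map_comp:
  assumes "p \<in> dist_on S" "\<And>s. s \<in> S \<Longrightarrow> h s = g (f s)"
  shows "dist_map h p = dist_map g (dist_map f p)"
proof
  fix t
  note fin = distD(1)[OF assms(1)]
  have fin2: "finite {s. dist_map f p s \<noteq> 0}"
    using dist_map_supp fin by (rule finite_subset[OF _ finite_imageI])
  have "dist_map g (dist_map f p) t = (\<Sum>s | p s \<noteq> 0. p s * (if g (f s) = t then 1 else 0))"
    unfolding dist_map_eq[OF fin2 subset_refl] by (rule sum_dist_map[OF fin])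
  also have "\<dots> = dist_map h p t"
    unfolding dist_map_eq[OF fin subset_refl] using distD(2)[OF assms(1)] assms(2)
    by (intro sum.cong) (auto simp: subset_iff)
  finally show "dist_map h p t = dist_map g (dist_map f p) t" ..
qed

lemma simplicial_set_dist_sset:
  assumes "simplicial_set Y"
  shows "simplicial_set (dist_sset Y)"
proof -
  interpret simplicial_set Y by fact
  show ?thesis
    by standard
      (auto simp: dist_sset_def act_closed act_id act_comp
        intro: dist_map_in_dist dist_map_id dist_map_comp)
qed

lemma sum_delta:
  fixes h :: "'s \<Rightarrow> 'r::{comm_semiring_0, comm_monoid_mult}"
  shows "(\<Sum>t | (delta s t :: 'r) \<noteq> 0. delta s t * h t) = h s"
proof -
  have "(\<Sum>t | (delta s t :: 'r) \<noteq> 0. delta s t * h t) = (\<Sum>t\<in>{s}. delta s t * h t)"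
  proof (rule sum.mono_neutral_left)
    show "{t. (delta s t :: 'r) \<noteq> 0} \<subseteq> {s}" by (auto simp: delta_def split: if_splits)
  qed auto
  then show ?thesis by (simp add: delta_def)
qed

lemma delta_in_dist:
  assumes "s \<in> S"
  shows "(delta s :: 's \<Rightarrow> 'r::{comm_semiring_0, comm_monoid_mult}) \<in> dist_on S"
proof -
  have sub: "{t. (delta s t :: 'r) \<noteq> 0} \<subseteq> {s}"
    by (auto simp: delta_def split: if_splits)
  then have "finite {t. (delta s t :: 'r) \<noteq> 0}"
    by (rule finite_subset) simp
  moreover have "{t. (delta s t :: 'r) \<noteq> 0} \<subseteq> S"
    using sub assms by blast
  ultimately show ?thesis
    using sum_delta[of s "\<lambda>_. 1 :: 'r"] by (simp add: dist_on_def)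
qed

lemma dist_map_delta:
  "dist_map f (delta s :: 's \<Rightarrow> 'r::{comm_semiring_0, comm_monoid_mult}) = delta (f s)"
proof
  fix t
  have fin: "finite {t. (delta s t :: 'r) \<noteq> 0}"
    by (rule finite_subset[of _ "{s}"]) (auto simp: delta_def)
  show "dist_map f (delta s) t = (delta (f s) t :: 'r)"
    unfolding dist_map_eq[OF fin subset_refl] sum_delta by (simp add: delta_def)
qed

lemma delta_sset_in_sSet:
  assumes "simplicial_set Y"
  shows "delta_sset Y \<in> sSet Y (dist_sset Y)"
  using simplicial_set.act_closed[OF assms]
  by (auto simp: sSet_def dist_sset_def delta_sset_def delta_in_dist dist_map_delta)

lemma dist_combination:
  assumes "finite A" "(\<Sum>i\<in>A. c i) = 1" "\<And>i. i \<in> A \<Longrightarrow> q i \<in> dist_on S"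
  shows "(\<lambda>s. \<Sum>i\<in>A. c i * q i s) \<in> dist_on S"
proof -
  let ?B = "\<Union>i\<in>A. {s. q i s \<noteq> 0}"
  let ?r = "\<lambda>s. \<Sum>i\<in>A. c i * q i s"
  have B: "finite ?B" "?B \<subseteq> S" using assms(1) distD(1,2)[OF assms(3)] by blast+
  have sub: "{s. ?r s \<noteq> 0} \<subseteq> ?B"
  proof
    fix s assume "s \<in> {s. ?r s \<noteq> 0}"
    then obtain i where "i \<in> A" "c i * q i s \<noteq> 0"
      by (auto elim: sum.not_neutral_contains_not_neutral)
    then have "q i s \<noteq> 0" by (metis mult_zero_right)
    with \<open>i \<in> A\<close> show "s \<in> ?B" by blast
  qed
  have "(\<Sum>s | ?r s \<noteq> 0. ?r s) = (\<Sum>s\<in>?B. ?r s)"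
    using B sub by (intro sum.mono_neutral_left) auto
  also have "\<dots> = (\<Sum>i\<in>A. c i * (\<Sum>s\<in>?B. q i s))"
    by (subst sum.swap) (simp add: sum_distrib_left)
  also have "\<dots> = (\<Sum>i\<in>A. c i)"
  proof (intro sum.cong refl)
    fix i assume i: "i \<in> A"
    have "(\<Sum>s\<in>?B. q i s) = (\<Sum>s | q i s \<noteq> 0. q i s)"
      using B i by (intro sum.mono_neutral_right) auto
    then show "c i * (\<Sum>s\<in>?B. q i s) = c i" using distD(3)[OF assms(3)[OF i]] by simp
  qed
  finally show ?thesis using assms(2) B sub finite_subset[OF sub] by (simp add: dist_on_def subset_trans)
qed

lemma dist_map_combination:
  assumes "finite A" "\<And>i. i \<in> A \<Longrightarrow> q i \<in> dist_on S"
  shows "dist_map f (\<lambda>s. \<Sum>i\<in>A. c i * q i s) = (\<lambda>t. \<Sum>i\<in>A. c i * dist_map f (q i) t)"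
proof
  fix t
  let ?B = "\<Union>i\<in>A. {s. q i s \<noteq> 0}"
  have B: "finite ?B" using assms(1) distD(1)[OF assms(2)] by blast
  have sub: "{s. (\<Sum>i\<in>A. c i * q i s) \<noteq> 0} \<subseteq> ?B"
  proof
    fix s assume "s \<in> {s. (\<Sum>i\<in>A. c i * q i s) \<noteq> 0}"
    then obtain i where "i \<in> A" "c i * q i s \<noteq> 0"
      by (auto elim: sum.not_neutral_contains_not_neutral)
    then have "q i s \<noteq> 0" by (metis mult_zero_right)
    with \<open>i \<in> A\<close> show "s \<in> ?B" by blast
  qed
  have "dist_map f (\<lambda>s. \<Sum>i\<in>A. c i * q i s) t
      = (\<Sum>i\<in>A. c i * (\<Sum>s\<in>?B. q i s * (if f s = t then 1 else 0)))"
    unfolding dist_map_eq[OF B sub] sum_distrib_right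
    by (subst sum.swap) (simp add: sum_distrib_left mult.assoc)
  also have "\<dots> = (\<Sum>i\<in>A. c i * dist_map f (q i) t)"
    using B by (intro sum.cong refl arg_cong2[where f="(*)"] dist_map_eq[symmetric]) auto
  finally show "dist_map f (\<lambda>s. \<Sum>i\<in>A. c i * q i s) t
      = (\<Sum>i\<in>A. c i * dist_map f (q i) t)" .
qed

text \<open>
  With the structure map \<open>sSet_str Z\<close>, the set of simplicial maps $Z \to D_R(Y)$ is a convex set.
\<close>

lemma convex_set_sSet:
  fixes Y :: "'b sset" and Z :: "'z sset"
  assumes Z: "simplicial_set Z"
  shows "convex_set (sSet Z (dist_sset Y))
    (sSet_str Z :: ((nat \<Rightarrow> 'z \<Rightarrow> 'b \<Rightarrow> 'r::{comm_semiring_0, comm_monoid_mult}) \<Rightarrow> 'r) \<Rightarrow> _)"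
proof
  fix Q :: "(nat \<Rightarrow> 'z \<Rightarrow> 'b \<Rightarrow> 'r) \<Rightarrow> 'r"
  assume Q: "Q \<in> dist_on (sSet Z (dist_sset Y))"
  let ?A = "{p. Q p \<noteq> 0}"
  have A: "finite ?A" "?A \<subseteq> sSet Z (dist_sset Y)" "sum Q ?A = 1" using distD[OF Q] by auto
  have pd: "p n z \<in> dist_on (cells Y n)" if "p \<in> ?A" "z \<in> cells Z n" for p n z
    using A that by (auto simp: sSet_def dist_sset_def PiE_iff)
  have nat: "p m (act Z m n \<theta> z) = dist_map (act Y m n \<theta>) (p n z)"
    if "p \<in> ?A" "z \<in> cells Z n" "\<theta> \<in> Delta_hom m n" for p n z m \<theta>
    using A that by (auto simp: sSet_def dist_sset_def)
  have "(\<lambda>y. \<Sum>p\<in>?A. Q p * p n z y) \<in> dist_on (cells Y n)" if "z \<in> cells Z n" for n z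
    using dist_combination[OF A(1,3), of "\<lambda>p. p n z"] pd that by auto
  moreover have "(\<lambda>y. \<Sum>p\<in>?A. Q p * p m (act Z m n \<theta> z) y)
      = dist_map (act Y m n \<theta>) (\<lambda>y. \<Sum>p\<in>?A. Q p * p n z y)"
    if "z \<in> cells Z n" "\<theta> \<in> Delta_hom m n" for m n \<theta> z
    using dist_map_combination[OF A(1), of "\<lambda>p. p n z" "cells Y n" "act Y m n \<theta>" Q] pd nat that
    by (auto intro!: ext sum.cong)
  ultimately show "sSet_str Z Q \<in> sSet Z (dist_sset Y)"
    using simplicial_set.act_closed[OF Z]
    by (auto simp: sSet_def sSet_str_def dist_sset_def)
next
  fix p :: "nat \<Rightarrow> 'z \<Rightarrow> 'b \<Rightarrow> 'r"
  assume "p \<in> sSet Z (dist_sset Y)"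
  then show "sSet_str Z (delta p) = p"
    by (auto simp: sSet_str_def sum_delta sSet_def PiE_iff extensional_def fun_eq_iff)
next
  fix P :: "((nat \<Rightarrow> 'z \<Rightarrow> 'b \<Rightarrow> 'r) \<Rightarrow> 'r) \<Rightarrow> 'r"
  assume P: "P \<in> dist_on (dist_on (sSet Z (dist_sset Y)))"
  let ?A = "{Q. P Q \<noteq> 0}"
  let ?B = "\<Union>Q\<in>?A. {p. Q p \<noteq> 0}"
  have A: "finite ?A" "?A \<subseteq> dist_on (sSet Z (dist_sset Y))" using distD[OF P] by auto
  then have B: "finite ?B" using distD(1) by blast
  have sub: "{p. dist_join P p \<noteq> 0} \<subseteq> ?B"
  proof
    fix p assume "p \<in> {p. dist_join P p \<noteq> 0}"
    then obtain Q where "Q \<in> ?A" "P Q * Q p \<noteq> 0"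
      unfolding dist_join_def by (auto elim: sum.not_neutral_contains_not_neutral)
    then have "Q p \<noteq> 0" by (metis mult_zero_right)
    with \<open>Q \<in> ?A\<close> show "p \<in> ?B" by blast
  qed
  show "sSet_str Z (dist_map (sSet_str Z) P) = sSet_str Z (dist_join P)"
  proof (intro ext)
    fix n z y
    show "sSet_str Z (dist_map (sSet_str Z) P) n z y = sSet_str Z (dist_join P) n z y"
    proof (cases "z \<in> cells Z n")
      case True
      have "sSet_str Z (dist_map (sSet_str Z) P) n z y
          = (\<Sum>Q\<in>?A. P Q * sSet_str Z Q n z y)"
        using True sum_dist_map[OF A(1), of "sSet_str Z" "\<lambda>p. p n z y"]
        by (simp add: sSet_str_def)
      also have "\<dots> = (\<Sum>Q\<in>?A. P Q * (\<Sum>p\<in>?B. Q p * p n z y))"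
      proof (intro sum.cong refl arg_cong2[where f="(*)"])
        fix Q assume "Q \<in> ?A"
        then have "(\<Sum>p\<in>?B. Q p * p n z y) = (\<Sum>p | Q p \<noteq> 0. Q p * p n z y)"
          using B by (intro sum.mono_neutral_right) auto
        then show "sSet_str Z Q n z y = (\<Sum>p\<in>?B. Q p * p n z y)"
          using True by (simp add: sSet_str_def)
      qed
      also have "\<dots> = (\<Sum>p\<in>?B. dist_join P p * p n z y)"
        unfolding dist_join_def sum_distrib_left sum_distrib_right
        by (subst sum.swap) (simp add: mult.assoc)
      also have "\<dots> = (\<Sum>p | dist_join P p \<noteq> 0. dist_join P p * p n z y)"
        using B sub by (intro sum.mono_neutral_right) auto
      finally show ?thesis using True by (simp add: sSet_str_def)
    qed (simp add: sSet_str_def)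
  qed
qed

end

theory Submission
  imports Defs
begin

text \<open>
  A point of the support of \<open>F\<close> restricts, at the two ends of the cylinder, to a point of the support
  of a delta distribution, hence to \<open>\<phi>1\<close> and \<open>\<phi>2\<close>; it would be a homotopy. If \<open>F\<close> is a convex
  combination of maps \<open>p\<close>, then zero-sum-freeness and integrality confine each \<open>p\<close> with nonzero weight
  to the support of \<open>F\<close>; at the ends such a \<open>p\<close> is therefore again a delta distribution, so it is a
  homotopy between the same maps and equals \<open>F\<close> by uniqueness.
\<close>

text \<open>Splitting off the summand at \<open>i\<close> leaves a binary sum, so one use of
  zero-sum-freeness is enough and no induction on \<open>A\<close> is required.\<close>

lemma sum_eq_0D:
  fixes f :: "'i \<Rightarrow> 'r::comm_monoid_add"
  assumes "\<And>a b :: 'r. a + b = 0 \<Longrightarrow> a = 0 \<and> b = 0"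
    and "finite A" "sum f A = 0" "i \<in> A"
  shows "f i = 0"
  using assms by (metis sum.remove)

lemma dist_on_singleton:
  fixes p :: "'s \<Rightarrow> 'r::{comm_semiring_0, comm_monoid_mult}"
  assumes "p \<in> dist_on S" and zero: "\<And>t. t \<noteq> s \<Longrightarrow> p t = 0"
  shows "p = delta s"
proof
  \<comment> \<open>Summing over \<open>{s}\<close> avoids a case split: \<open>p s = 0\<close> can
    occur only when \<open>0 = 1\<close> in the semiring.\<close>
  have "(\<Sum>t | p t \<noteq> 0. p t) = (\<Sum>t\<in>{s}. p t)"
    using zero by (intro sum.mono_neutral_left) auto
  then have "p s = 1"
    using distD(3)[OF assms(1)] by simp
  then show "p t = delta s t" for t
    using zero by (simp add: delta_def)
qed

lemma delta_neq_0D: "delta s t \<noteq> 0 \<Longrightarrow> t = s"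
  by (simp add: delta_def split: if_splits)

lemma sSet_dist:
  assumes "p \<in> sSet Z (dist_sset Y)" "z \<in> cells Z n"
  shows "p n z \<in> dist_on (cells Y n)"
  using assms by (auto simp: sSet_def dist_sset_def)

lemma smap_comp_eqI:
  assumes "\<And>n. f n \<in> extensional (cells X n)"
    and "\<And>n x. x \<in> cells X n \<Longrightarrow> g n (h n x) = f n x"
  shows "f = smap_comp X g h"
  using assms by (auto simp: smap_comp_def compose_def extensional_def fun_eq_iff)

lemma sSet_extensional: "f \<in> sSet X Y \<Longrightarrow> f n \<in> extensional (cells X n)"
  by (auto simp: sSet_def PiE_def)

lemma sSet_closed: "f \<in> sSet X Y \<Longrightarrow> x \<in> cells X n \<Longrightarrow> f n x \<in> cells Y n"
  by (auto simp: sSet_def)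

text \<open>The end condition of a homotopy, read off at one simplex; \<open>h\<close> will be an
  end inclusion of the cylinder.\<close>

lemma smap_comp_delta_apply:
  assumes "f \<in> sSet X Y" "smap_comp X (delta_sset Y) f = smap_comp X F h" "x \<in> cells X n"
  shows "F n (h n x) = delta (f n x)"
  using fun_cong[OF fun_cong[OF assms(2)], of n x] sSet_closed[OF assms(1,3)] assms(3)
  by (simp add: smap_comp_def compose_def delta_sset_def)

text \<open>On the image of \<open>h\<close> the value of \<open>F\<close> is a delta distribution,
  whose only point of nonzero weight is its base point, so \<open>\<psi>\<close> has no choice
  there.\<close>

lemma supp_restrict_delta:
  assumes f: "f \<in> sSet X Y" and h: "h \<in> sSet X Z"
    and F: "smap_comp X (delta_sset Y) f = smap_comp X F h"
    and \<psi>: "\<psi> \<in> supp Z Y F"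
  shows "f = smap_comp X \<psi> h"
proof (rule smap_comp_eqI)
  fix n x assume x: "x \<in> cells X n"
  have "F n (h n x) (\<psi> n (h n x)) \<noteq> 0"
    using \<psi> sSet_closed[OF h x] by (auto simp: supp_def)
  then show "\<psi> n (h n x) = f n x"
    by (simp add: smap_comp_delta_apply[OF f F x] delta_neq_0D)
qed (rule sSet_extensional[OF f])

text \<open>By \<open>absorb\<close>, over the image of \<open>h\<close> the distributions of
  \<open>p\<close> live on the single point carrying those of \<open>F\<close>; normalization then
  makes them equal to the same delta.\<close>

lemma summand_restrict_delta:
  fixes p :: "nat \<Rightarrow> 'z \<Rightarrow> 'b \<Rightarrow> 'r::{comm_semiring_0, comm_monoid_mult}"
  assumes f: "f \<in> sSet X Y" and h: "h \<in> sSet X Z"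
    and F: "smap_comp X (delta_sset Y) f = smap_comp X F h"
    and p: "p \<in> sSet Z (dist_sset Y)"
    and absorb: "\<And>n z y. \<lbrakk>z \<in> cells Z n; F n z y = 0\<rbrakk> \<Longrightarrow> p n z y = 0"
  shows "smap_comp X (delta_sset Y) f = smap_comp X p h"
proof (rule smap_comp_eqI)
  show "smap_comp X (delta_sset Y) f n \<in> extensional (cells X n)" for n
    by (simp add: smap_comp_def)
  fix n x assume x: "x \<in> cells X n"
  note hx = sSet_closed[OF h x]
  have "p n (h n x) = delta (f n x)"
  proof (rule dist_on_singleton[OF sSet_dist[OF p hx]])
    fix t assume "t \<noteq> f n x"
    then show "p n (h n x) t = 0"
      by (intro absorb[OF hx]) (simp add: smap_comp_delta_apply[OF f F x] delta_def)
  qed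
  then show "p n (h n x) = smap_comp X (delta_sset Y) f n x"
    using x sSet_closed[OF f x] by (simp add: smap_comp_def compose_def delta_sset_def)
qed

theorem corollary5p23:
  fixes X :: "'a sset"
    and Y :: "'b sset"
    and \<phi>1 \<phi>2 :: "nat \<Rightarrow> 'a \<Rightarrow> 'b"
    and F :: "nat \<Rightarrow> 'a \<times> (nat \<Rightarrow> nat) \<Rightarrow> 'b \<Rightarrow> 'r::{comm_semiring_0, comm_monoid_mult}"
  assumes zero_sum_free: "\<And>a b :: 'r. a + b = 0 \<Longrightarrow> a = 0 \<and> b = 0"
    and integral: "\<And>a b :: 'r. a * b = 0 \<Longrightarrow> a = 0 \<or> b = 0"
    and "simplicial_set X"
    and "simplicial_set Y"
    and "\<phi>1 \<in> sSet X Y"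
    and "\<phi>2 \<in> sSet X Y"
    and no_homotopy: "\<not> (\<exists>H. simplicial_homotopy X Y \<phi>1 \<phi>2 H)"
    and homotopy: "simplicial_homotopy X (dist_sset Y)
          (smap_comp X (delta_sset Y) \<phi>1) (smap_comp X (delta_sset Y) \<phi>2) F"
    and unique: "\<And>G. simplicial_homotopy X (dist_sset Y)
          (smap_comp X (delta_sset Y) \<phi>1) (smap_comp X (delta_sset Y) \<phi>2) G \<Longrightarrow> G = F"
  shows "strongly_contextual (sprod X (std_simplex 1)) Y F \<and>
    vertex (sSet (sprod X (std_simplex 1)) (dist_sset Y))
      (sSet_str (sprod X (std_simplex 1))) F"
proof
  let ?Z = "sprod X (std_simplex 1)"
  let ?S = "sSet ?Z (dist_sset Y :: ('b \<Rightarrow> 'r) sset)"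
  note incl = end_incl_in_sSet[OF assms(3)]
  have F: "F \<in> ?S"
    and F1: "smap_comp X (delta_sset Y) \<phi>1 = smap_comp X F (end_incl X 1)"
    and F2: "smap_comp X (delta_sset Y) \<phi>2 = smap_comp X F (end_incl X 0)"
    using homotopy by (auto simp: simplicial_homotopy_def)
  show "strongly_contextual ?Z Y F"
    unfolding strongly_contextual_def
  proof (rule equals0I)
    fix \<psi> assume \<psi>: "\<psi> \<in> supp ?Z Y F"
    have "simplicial_homotopy X Y \<phi>1 \<phi>2 \<psi>"
      unfolding simplicial_homotopy_def
      using \<psi> supp_restrict_delta[OF assms(5) incl F1 \<psi>] supp_restrict_delta[OF assms(6) incl F2 \<psi>]
      by (simp add: supp_def)
    with no_homotopy show False by blast
  qed
  interpret convex_set ?S "sSet_str ?Z"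
    by (intro convex_set_sSet simplicial_set_sprod simplicial_set_std_simplex assms(3))
  show "vertex ?S (sSet_str ?Z) F"
    unfolding vertex_def
  proof (intro conjI ex1I)
    show "F \<in> ?S" "delta F \<in> dist_on ?S" "sSet_str ?Z (delta F) = F"
      \<comment> \<open>Existence of a preimage is the unit law of the convex structure.\<close>
      by (rule F delta_in_dist[OF F] str_delta[OF F])+
    fix Q assume "Q \<in> dist_on ?S \<and> sSet_str ?Z Q = F"
    then have Q: "Q \<in> dist_on ?S" and QF: "sSet_str ?Z Q = F" by auto
    show "Q = delta F"
    \<comment> \<open>The one-point criterion now serves one level up, for the distribution
      \<open>Q\<close> on simplicial maps: it remains to exclude any \<open>p\<close> other than
      \<open>F\<close> of nonzero weight.\<close>
    proof (rule dist_on_singleton[OF Q], rule ccontr)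
      fix p assume "p \<noteq> F" and Qp: "Q p \<noteq> 0"
      have p: "p \<in> ?S" using distD(2)[OF Q] Qp by blast
      have absorb: "p n z y = 0" if "z \<in> cells ?Z n" "F n z y = 0" for n z y
      proof -
        have "(\<Sum>q | Q q \<noteq> 0. Q q * q n z y) = 0"
          using that by (simp flip: QF add: sSet_str_def)
        \<comment> \<open>Nothing cancels in a zero-sum-free semiring, so the summand of
          \<open>p\<close> vanishes; integrality then removes the factor \<open>Q p\<close>.\<close>
        then have "Q p * p n z y = 0"
          using sum_eq_0D[OF zero_sum_free distD(1)[OF Q], of "\<lambda>q. Q q * q n z y"] Qp by blast
        with integral Qp show ?thesis by blast
      qed
      have "simplicial_homotopy X (dist_sset Y)
          (smap_comp X (delta_sset Y) \<phi>1) (smap_comp X (delta_sset Y) \<phi>2) p"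
        unfolding simplicial_homotopy_def
        using p summand_restrict_delta[OF assms(5) incl F1 p absorb]
          summand_restrict_delta[OF assms(6) incl F2 p absorb]
        by blast
      with unique \<open>p \<noteq> F\<close> show False by blast
    qed
  qed
qed

end
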